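(* Consider one of the following: (1) the Stratonovich signature of a $d$-dimensional Brownian motion; (2) the Itô signature of a $d$-dimensional Ornstein–Uhlenbeck (OU) process; (3) the Stratonovich signature of a $d$-dimensional OU process. For $0\le m,n\le 2K$ let $\Psi_{m,n}$ be the correlation matrix between all $m$-th order and all $n$-th order signature components. Then the correlation matrix $\Delta^2$ of the signature truncated to order $2K$ (components arranged by increasing order) has an odd–even alternating structure: its $(m,n)$ block is $\Psi_{m,n}$ if $m+n$ is even and is $0$ if $m+n$ is odd, i.e. $$\Delta^2=\begin{pmatrix}\Psi_{0,0}&0&\Psi_{0,2}&\cdots&0&\Psi_{0,2K}\\0&\Psi_{1,1}&0&\cdots&\Psi_{1,2K-1}&0\\\Psi_{2,0}&0&\Psi_{2,2}&\cdots&0&\Psi_{2,2K}\\\vdots&\vdots&\vdots&\ddots&\vdots&\vdots\\0&\Psi_{2K-1,1}&0&\cdots&\Psi_{2K-1,2K-1}&0\\\Psi_{2K,0}&0&\Psi_{2K,2}&\cdots&0&\Psi_{2K,2K}\end{pmatrix}.$$ In particular, if the components are rearranged with all odd-order components together and all even-order components together, the correlation matrix is block diagonal, $\tilde\Delta^2=\mathrm{diag}\{\Psi_{\mathrm{odd}},\Psi_{\mathrm{even}}\}$, where $\Psi_{\mathrm{odd}}=(\Psi_{m,n})_{m,n\in\{1,3,\dots,2K-1\}}$ and $\Psi_{\mathrm{even}}=(\Psi_{m,n})_{m,n\in\{0,2,\dots,2K\}}$ (block matrices).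
   Context: Brownian motion: $\mathbf{X}_t=\Gamma(W^1_t,\dots,W^d_t)^\top$ with $W^i$ independent standard Brownian motions and $\Gamma$ a constant matrix. OU process: $\mathbf{X}_t=\Gamma(Y^1_t,\dots,Y^d_t)^\top$ with $\Gamma$ a constant $d\times d$ matrix and $Y^1,\dots,Y^d$ independent one-dimensional OU processes $dY^i_t=-\kappa_iY^i_t\,dt+dW^i_t$, $Y^i_0=0$, $\kappa_i>0$, with $W^i$ standard Brownian motions. Signature: the $0$-th order component is $1$; for $i_1,\dots,i_k\in\{1,\dots,d\}$ the $k$-th order component is $S(\mathbf{X})^{i_1,\dots,i_k}_t=\int_0^tS(\mathbf{X})^{i_1,\dots,i_{k-1}}_s\,dX^{i_k}_s$, with the integrals all in the Itô sense (Itô signature) or all in the Stratonovich sense (Stratonovich signature). Components are evaluated at a fixed time $t>0$. Correlations are uncentered: the correlation of $U,V$ is $\mathbb{E}[UV]/\sqrt{\mathbb{E}[U^2]\mathbb{E}[V^2]}$; all components are assumed to have positive second moment so that these are defined. *)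

theory Defs
  imports "HOL-Probability.Probability" "Jordan_Normal_Form.Matrix"
begin

text \<open>Processes have type \<^typ>\<open>real \<Rightarrow> 'a \<Rightarrow> 'b\<close> (time, then sample point); only times \<open>t \<ge> 0\<close>
  are ever constrained.\<close>

definition standard_brownian_motion :: "'a measure \<Rightarrow> (real \<Rightarrow> 'a \<Rightarrow> real) \<Rightarrow> bool" where
  "standard_brownian_motion M W \<longleftrightarrow>
     (\<forall>t\<ge>0. W t \<in> borel_measurable M) \<and>
     (AE \<omega> in M. W 0 \<omega> = 0) \<and>
     (AE \<omega> in M. continuous_on {0..} (\<lambda>t. W t \<omega>)) \<and>
     (\<forall>s t. 0 \<le> s \<longrightarrow> s < t \<longrightarrow>
        distributed M lborel (\<lambda>\<omega>. W t \<omega> - W s \<omega>) (normal_density 0 (sqrt (t - s)))) \<and>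
     (\<forall>(n::nat) \<tau>. 0 \<le> \<tau> 0 \<longrightarrow> (\<forall>k<n. \<tau> k < \<tau> (Suc k)) \<longrightarrow>
        prob_space.indep_vars M (\<lambda>_. borel) (\<lambda>k \<omega>. W (\<tau> (Suc k)) \<omega> - W (\<tau> k) \<omega>) {..<n})"

text \<open>Independence of the processes as random elements of the path space, i.e. of the
  \<open>\<sigma>\<close>-algebras they generate.\<close>

definition independent_processes :: "'a measure \<Rightarrow> ('d \<Rightarrow> real \<Rightarrow> 'a \<Rightarrow> real) \<Rightarrow> bool" where
  "independent_processes M Y \<longleftrightarrow>
     prob_space.indep_vars M (\<lambda>_. Pi\<^sub>M {0..} (\<lambda>_. borel)) (\<lambda>j \<omega>. \<lambda>t\<in>{0..}. Y j t \<omega>) UNIV"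

text \<open>The equation \<open>dY = - \<kappa> Y dt + dW\<close>, \<open>Y\<^sub>0 = 0\<close>, in its integrated form
  (the noise is additive, so the equation is pathwise).\<close>

definition ou_process ::
    "'a measure \<Rightarrow> real \<Rightarrow> (real \<Rightarrow> 'a \<Rightarrow> real) \<Rightarrow> (real \<Rightarrow> 'a \<Rightarrow> real) \<Rightarrow> bool" where
  "ou_process M \<kappa> W Y \<longleftrightarrow>
     (\<forall>t\<ge>0. Y t \<in> borel_measurable M) \<and>
     (AE \<omega> in M. continuous_on {0..} (\<lambda>t. Y t \<omega>) \<and> Y 0 \<omega> = 0 \<and>
        (\<forall>t\<ge>0. Y t \<omega> = - \<kappa> * integral {0..t} (\<lambda>s. Y s \<omega>) + W t \<omega>))"

definition multidim_brownian_motion :: "'a measure \<Rightarrow> (real \<Rightarrow> 'a \<Rightarrow> real^'d) \<Rightarrow> bool" where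
  "multidim_brownian_motion M X \<longleftrightarrow>
     (\<exists>(\<Gamma> :: real^'d^'d) W.
        (\<forall>j. standard_brownian_motion M (W j)) \<and>
        independent_processes M W \<and>
        (\<forall>t\<ge>0. \<forall>\<omega>\<in>space M. X t \<omega> = \<Gamma> *v (\<chi> j. W j t \<omega>)))"

definition multidim_ou_process :: "'a measure \<Rightarrow> (real \<Rightarrow> 'a \<Rightarrow> real^'d) \<Rightarrow> bool" where
  "multidim_ou_process M X \<longleftrightarrow>
     (\<exists>(\<Gamma> :: real^'d^'d) \<kappa> W Y.
        (\<forall>j. \<kappa> j > 0) \<and>
        (\<forall>j. standard_brownian_motion M (W j)) \<and>
        (\<forall>j. ou_process M (\<kappa> j) (W j) (Y j)) \<and>
        independent_processes M Y \<and>
        (\<forall>t\<ge>0. \<forall>\<omega>\<in>space M. X t \<omega> = \<Gamma> *v (\<chi> j. Y j t \<omega>)))"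

text \<open>Partitions \<open>0 = s\<^sub>0 < \<dots> < s\<^sub>N = t\<close>, and the filter \<open>mesh \<longlonglongrightarrow> 0\<close> on them.\<close>

definition partitions :: "real \<Rightarrow> real list set" where
  "partitions t = {ts. ts \<noteq> [] \<and> hd ts = 0 \<and> last ts = t \<and> sorted_wrt (<) ts}"

definition mesh_to_0 :: "real \<Rightarrow> real list filter" where
  "mesh_to_0 t = (INF \<delta>\<in>{0<..}.
     principal {ts \<in> partitions t. \<forall>k. Suc k < length ts \<longrightarrow> ts ! Suc k - ts ! k < \<delta>})"

datatype integral_sense = Ito | Stratonovich

fun riemann_sum :: "integral_sense \<Rightarrow> (real \<Rightarrow> 'a \<Rightarrow> real) \<Rightarrow> (real \<Rightarrow> 'a \<Rightarrow> real) \<Rightarrow>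
    real list \<Rightarrow> 'a \<Rightarrow> real" where
  "riemann_sum Ito H X ts \<omega> =
     (\<Sum>k<length ts - 1. H (ts ! k) \<omega> * (X (ts ! Suc k) \<omega> - X (ts ! k) \<omega>))"
| "riemann_sum Stratonovich H X ts \<omega> =
     (\<Sum>k<length ts - 1. (H (ts ! k) \<omega> + H (ts ! Suc k) \<omega>) / 2 *
        (X (ts ! Suc k) \<omega> - X (ts ! k) \<omega>))"

definition tendsto_in_probability ::
    "'a measure \<Rightarrow> ('i \<Rightarrow> 'a \<Rightarrow> real) \<Rightarrow> ('a \<Rightarrow> real) \<Rightarrow> 'i filter \<Rightarrow> bool" where
  "tendsto_in_probability M U Z F \<longleftrightarrow>
     (\<forall>\<epsilon>>0. ((\<lambda>i. measure M {\<omega> \<in> space M. \<bar>U i \<omega> - Z \<omega>\<bar> > \<epsilon>}) \<longlongrightarrow> 0) F)"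

text \<open>\<open>Z\<close> is the integral of \<open>H\<close> against \<open>X\<close> over \<open>[0, t]\<close>, as the limit in probability of the
  left-point (Ito) or averaged (Stratonovich) sums. For integrands that are, up to modification,
  continuous semimartingales, and continuous semimartingale integrators, this limit exists and is
  the usual integral; iterated integrals only ever involve such integrands. The sums, hence the
  limit, only change on a null set when \<open>H\<close> or \<open>X\<close> is replaced by a modification.\<close>

definition has_stochastic_integral ::
    "'a measure \<Rightarrow> integral_sense \<Rightarrow> (real \<Rightarrow> 'a \<Rightarrow> real) \<Rightarrow> (real \<Rightarrow> 'a \<Rightarrow> real) \<Rightarrow>
      real \<Rightarrow> ('a \<Rightarrow> real) \<Rightarrow> bool" where
  "has_stochastic_integral M c H X t Z \<longleftrightarrow>
     Z \<in> borel_measurable M \<and> tendsto_in_probability M (riemann_sum c H X) Z (mesh_to_0 t)"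

text \<open>Components are indexed by words over the coordinates; each is determined up to modification.\<close>

definition is_signature ::
    "'a measure \<Rightarrow> integral_sense \<Rightarrow> (real \<Rightarrow> 'a \<Rightarrow> real^'d) \<Rightarrow>
      ('d list \<Rightarrow> real \<Rightarrow> 'a \<Rightarrow> real) \<Rightarrow> bool" where
  "is_signature M c X S \<longleftrightarrow>
     (\<forall>t\<ge>0. \<forall>\<omega>\<in>space M. S [] t \<omega> = 1) \<and>
     (\<forall>w i. \<forall>t\<ge>0. has_stochastic_integral M c (S w) (\<lambda>s \<omega>. vec_nth (X s \<omega>) i) t (S (w @ [i]) t))"

definition uncentered_correlation :: "'a measure \<Rightarrow> ('a \<Rightarrow> real) \<Rightarrow> ('a \<Rightarrow> real) \<Rightarrow> real" where
  "uncentered_correlation M U V =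
     (\<integral>\<omega>. U \<omega> * V \<omega> \<partial>M) / sqrt ((\<integral>\<omega>. (U \<omega>)\<^sup>2 \<partial>M) * (\<integral>\<omega>. (V \<omega>)\<^sup>2 \<partial>M))"

definition correlation_matrix ::
    "'a measure \<Rightarrow> ('w \<Rightarrow> 'a \<Rightarrow> real) \<Rightarrow> 'w list \<Rightarrow> 'w list \<Rightarrow> real mat" where
  "correlation_matrix M U us vs =
     Matrix.mat (length us) (length vs) (\<lambda>(a, b). uncentered_correlation M (U (us ! a)) (U (vs ! b)))"

fun append_cols_list :: "'b::zero mat list \<Rightarrow> 'b mat" where
  "append_cols_list [] = 0\<^sub>m 0 0"
| "append_cols_list (A # As) =
     (let B = append_cols_list As
      in four_block_mat A B (0\<^sub>m 0 (dim_col A)) (0\<^sub>m 0 (dim_col B)))"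

fun append_rows_list :: "'b::zero mat list \<Rightarrow> 'b mat" where
  "append_rows_list [] = 0\<^sub>m 0 0"
| "append_rows_list (A # As) = A @\<^sub>r append_rows_list As"

definition block_matrix :: "nat list \<Rightarrow> nat list \<Rightarrow> (nat \<Rightarrow> nat \<Rightarrow> 'b::zero mat) \<Rightarrow> 'b mat" where
  "block_matrix ms ns B =
     append_rows_list (map (\<lambda>m. append_cols_list (map (\<lambda>n. B m n) ns)) ms)"

lemma mesh_to_0_neq_bot:
  assumes "t \<ge> 0"
  shows "mesh_to_0 t \<noteq> bot"
proof -
  have ne: "\<exists>ts \<in> partitions t. \<forall>k. Suc k < length ts \<longrightarrow> ts ! Suc k - ts ! k < \<delta>"
    if "\<delta> > 0" for \<delta>
  proof (cases "t = 0")
    case True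
    then show ?thesis by (intro bexI[of _ "[0]"]) (auto simp: partitions_def)
  next
    case False
    then have t: "t > 0" using assms by simp
    obtain N :: nat where N: "t / \<delta> < real N" using reals_Archimedean2 by blast
    with t that have N0: "N > 0" by (cases N) (auto simp: field_simps)
    define f where "f k = t * real k / real N" for k
    have mono: "f i < f j" if "i < j" for i j
      using that t N0 by (simp add: f_def divide_strict_right_mono)
    have step: "f (Suc k) - f k < \<delta>" for k
      using N N0 that by (simp add: f_def field_simps)
    show ?thesis
    proof (intro bexI[of _ "map f [0..<Suc N]"] allI impI)
      show "map f [0..<Suc N] \<in> partitions t"
        using N0 mono by (auto simp: partitions_def hd_map sorted_wrt_map f_def[of 0] f_def[of N]
            sorted_wrt_append intro!: sorted_wrt_mono_rel[OF _ sorted_wrt_upt] simp del: upt_Suc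
            simp: last_map)
      fix k assume "Suc k < length (map f [0..<Suc N])"
      then show "map f [0..<Suc N] ! Suc k - map f [0..<Suc N] ! k < \<delta>"
        using step[of k] by (simp del: upt_Suc)
    qed
  qed
  show ?thesis
    unfolding mesh_to_0_def
  proof (subst INF_filter_bot_base)
    fix d e :: real assume "d \<in> {0<..}" "e \<in> {0<..}"
    then show "\<exists>x\<in>{0<..}.
       principal {ts \<in> partitions t. \<forall>k. Suc k < length ts \<longrightarrow> ts ! Suc k - ts ! k < x}
       \<le> principal {ts \<in> partitions t. \<forall>k. Suc k < length ts \<longrightarrow> ts ! Suc k - ts ! k < d}
          \<sqinter> principal {ts \<in> partitions t. \<forall>k. Suc k < length ts \<longrightarrow> ts ! Suc k - ts ! k < e}"
      by (intro bexI[of _ "min d e"]) auto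
  qed (use ne in \<open>auto simp: principal_eq_bot_iff\<close>)
qed

lemma riemann_sum_measurable:
  assumes "ts \<in> partitions t"
    and "\<And>s. s \<ge> 0 \<Longrightarrow> H s \<in> borel_measurable M" "\<And>s. s \<ge> 0 \<Longrightarrow> X s \<in> borel_measurable M"
  shows "riemann_sum c H X ts \<in> borel_measurable M"
proof -
  have "ts ! k \<ge> 0" if "k < length ts" for k
  proof (cases k)
    case 0
    then show ?thesis using assms(1) by (auto simp: partitions_def simp flip: hd_conv_nth)
  next
    case (Suc j)
    then have "ts ! 0 < ts ! k"
      using assms(1) that by (intro sorted_wrt_nth_less[of "(<)"]) (auto simp: partitions_def)
    then show ?thesis using assms(1) by (auto simp: partitions_def simp flip: hd_conv_nth)
  qed
  then have [measurable]: "H (ts ! k) \<in> borel_measurable M" "X (ts ! k) \<in> borel_measurable M"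
    if "k < length ts" for k
    using assms(2,3) that by auto
  have "(\<lambda>\<omega>. riemann_sum c H X ts \<omega>) \<in> borel_measurable M"
    by (cases c) (auto intro!: borel_measurable_sum borel_measurable_times borel_measurable_diff
        borel_measurable_divide borel_measurable_add)
  then show ?thesis by simp
qed

lemma has_stochastic_integral_unique:
  assumes "prob_space M" "t \<ge> 0"
    and "\<And>s. s \<ge> 0 \<Longrightarrow> H s \<in> borel_measurable M" "\<And>s. s \<ge> 0 \<Longrightarrow> X s \<in> borel_measurable M"
    and "has_stochastic_integral M c H X t Z" "has_stochastic_integral M c H X t Z'"
  shows "AE \<omega> in M. Z \<omega> = Z' \<omega>"
proof -
  interpret prob_space M by fact
  have [measurable]: "Z \<in> borel_measurable M" "Z' \<in> borel_measurable M"
    using assms(5,6) by (auto simp: has_stochastic_integral_def)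
  have part: "eventually (\<lambda>ts. ts \<in> partitions t) (mesh_to_0 t)"
    unfolding mesh_to_0_def by (rule eventually_INF1[of 1]) (auto simp: eventually_principal)
  have far: "AE \<omega> in M. \<not> \<bar>Z \<omega> - Z' \<omega>\<bar> > 2 * \<epsilon>" if \<epsilon>: "\<epsilon> > 0" for \<epsilon>
  proof -
    let ?E = "{\<omega> \<in> space M. \<bar>Z \<omega> - Z' \<omega>\<bar> > 2 * \<epsilon>}"
    let ?A = "\<lambda>Y ts. {\<omega> \<in> space M. \<bar>riemann_sum c H X ts \<omega> - Y \<omega>\<bar> > \<epsilon>}"
    have "((\<lambda>ts. prob (?A Z ts) + prob (?A Z' ts)) \<longlongrightarrow> 0 + 0) (mesh_to_0 t)"
      using assms(5,6) \<epsilon>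
      by (intro tendsto_add) (auto simp: has_stochastic_integral_def tendsto_in_probability_def)
    moreover have "eventually (\<lambda>ts. prob ?E \<le> prob (?A Z ts) + prob (?A Z' ts)) (mesh_to_0 t)"
      using part
    proof eventually_elim
      case (elim ts)
      have [measurable]: "riemann_sum c H X ts \<in> borel_measurable M"
        using elim assms(3,4) by (rule riemann_sum_measurable)
      have "prob ?E \<le> prob (?A Z ts \<union> ?A Z' ts)"
        by (rule finite_measure_mono) auto
      also have "\<dots> \<le> prob (?A Z ts) + prob (?A Z' ts)"
        by (rule measure_Un_le) auto
      finally show ?case .
    qed
    ultimately have "prob ?E \<le> 0"
      using mesh_to_0_neq_bot[OF assms(2)] tendsto_lowerbound by fastforce
    then have "prob ?E = 0" by (simp add: measure_le_0_iff)
    then have "emeasure M ?E = 0" by (simp add: emeasure_eq_measure)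
    then show ?thesis by (subst AE_iff_measurable[OF _ refl]) auto
  qed
  have "AE \<omega> in M. \<forall>n. \<not> \<bar>Z \<omega> - Z' \<omega>\<bar> > 2 * inverse (real (Suc n))"
    unfolding AE_all_countable by (intro allI far) simp
  then show ?thesis
  proof eventually_elim
    case (elim \<omega>)
    show ?case
    proof (rule ccontr)
      assume "Z \<omega> \<noteq> Z' \<omega>"
      then obtain n where "inverse (real (Suc n)) < \<bar>Z \<omega> - Z' \<omega>\<bar> / 2"
        using reals_Archimedean[of "\<bar>Z \<omega> - Z' \<omega>\<bar> / 2"] by auto
      with elim show False by (auto simp: not_less dest: spec[of _ n])
    qed
  qed
qed

end

theory Submission
  imports Defs
begin

text \<open>Replacing \<open>X\<close> by \<open>- X\<close> multiplies a \<open>k\<close>-fold iterated integral by \<open>(- 1) ^ k\<close>, while the law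
  of \<open>X\<close> is symmetric. So if \<open>S w t\<close> is almost surely \<open>F X\<close> for a measurable functional \<open>F\<close> of
  the path, then \<open>F (- X)\<close> is \<open>(- 1) ^ length w * S w t\<close>, and the expectation of a product of two
  components whose orders have different parity equals its own negative. The functionals come from
  Riemann sums along almost surely convergent subsequences.\<close>

section \<open>Functionals of a path and its reflection\<close>

text \<open>A component is determined only almost surely, as a limit in probability, so there is no
  canonical path functional to evaluate at the reflected path, and no signature of the reflected
  process is given. The relation \<open>common_functional\<close> avoids constructing one. At each
  sample point, the Riemann sums built from reflected data are signed copies of the original sums,
  so a sequence of partitions along which the original sums converge almost surely serves both sides
  at once. Closure under sums, products and almost sure limits then carries the sign through all
  orders. The reflection acts on the independent coordinates behind \<open>X\<close>, not on
  \<open>X\<close> itself: their joint law is a product of symmetric laws, and \<open>X\<close> is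
  linear in them. For OU coordinates the symmetry is inherited from the driving Brownian motion,
  through the explicit pathwise solution of the equation.\<close>

lemma tendsto_in_probability_AE_subseq:
  fixes U :: "'i \<Rightarrow> 'a \<Rightarrow> real"
  assumes "prob_space M" "F \<noteq> bot"
    and lim: "tendsto_in_probability M U Z F"
    and P: "eventually P F"
    and U: "\<And>i. P i \<Longrightarrow> U i \<in> borel_measurable M"
    and Z[measurable]: "Z \<in> borel_measurable M"
  obtains ts :: "nat \<Rightarrow> 'i"
  where "\<And>n. P (ts n)" "AE \<omega> in M. (\<lambda>n. U (ts n) \<omega>) \<longlonglongrightarrow> Z \<omega>"
proof -
  interpret prob_space M by fact
  \<comment> \<open>The same 2^-n bounds the deviation and, for the chosen index, its probability:
    summability feeds Borel-Cantelli, and the vanishing threshold turns its conclusion into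
    convergence. As \<open>F\<close> is an arbitrary filter, the indices \<open>ts n\<close> are
    merely picked one by one and need not follow \<open>F\<close>.\<close>
  define far where "far i n = {\<omega> \<in> space M. \<bar>U i \<omega> - Z \<omega>\<bar> > (1/2)^n}" for i n
  have "\<exists>i. P i \<and> prob (far i n) < (1/2)^n" for n :: nat
  proof -
    have "((\<lambda>i. prob (far i n)) \<longlongrightarrow> 0) F"
      using lim by (simp add: tendsto_in_probability_def far_def)
    then have "eventually (\<lambda>i. prob (far i n) < (1/2)^n) F"
      by (rule order_tendstoD) simp
    with P have "eventually (\<lambda>i. P i \<and> prob (far i n) < (1/2)^n) F"
      by (rule eventually_conj)
    then show ?thesis using assms(2) eventually_happens' by blast
  qed
  then obtain ts where ts: "\<And>n. P (ts n)" "\<And>n. prob (far (ts n) n) < (1/2)^n"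
    by metis
  have [measurable]: "U (ts n) \<in> borel_measurable M" for n
    using ts(1) by (rule U)
  have "AE \<omega> in M. eventually (\<lambda>n. \<omega> \<in> space M - far (ts n) n) sequentially"
  proof (rule borel_cantelli_AE1)
    show "far (ts n) n \<in> sets M" for n unfolding far_def by measurable
    show "emeasure M (far (ts n) n) < \<infinity>" for n by (simp add: less_top[symmetric])
    show "summable (\<lambda>n. prob (far (ts n) n))"
      by (rule summable_comparison_test'[OF summable_geometric[of "1/2::real"], of 0])
        (use ts(2) in \<open>auto intro: less_imp_le\<close>)
  qed
  then have "AE \<omega> in M. (\<lambda>n. U (ts n) \<omega>) \<longlonglongrightarrow> Z \<omega>"
  proof eventually_elim
    case (elim \<omega>)
    then have "eventually (\<lambda>n. norm (U (ts n) \<omega> - Z \<omega>) \<le> (1/2)^n) sequentially"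
      by eventually_elim (auto simp: far_def)
    then have "(\<lambda>n. U (ts n) \<omega> - Z \<omega>) \<longlonglongrightarrow> 0"
      by (rule Lim_null_comparison) (auto intro: LIMSEQ_power_zero)
    then show ?case by (simp add: LIM_zero_iff)
  qed
  with ts(1) show ?thesis by (rule that)
qed

text \<open>\<open>U\<close> and \<open>V\<close> are the values of one and the same functional at the random elements \<open>\<Phi>\<close> and \<open>\<Psi>\<close>.
  With \<open>\<Psi> = - \<Phi>\<close> and \<open>V = \<plusminus> U\<close> this says that \<open>U\<close> is an even or odd functional of \<open>\<Phi>\<close>.\<close>

definition common_functional ::
    "'a measure \<Rightarrow> 'b measure \<Rightarrow> ('a \<Rightarrow> 'b) \<Rightarrow> ('a \<Rightarrow> 'b) \<Rightarrow> ('a \<Rightarrow> real) \<Rightarrow> ('a \<Rightarrow> real) \<Rightarrow> bool" where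
  "common_functional M N \<Phi> \<Psi> U V \<longleftrightarrow>
     (\<exists>F\<in>borel_measurable N. (AE \<omega> in M. U \<omega> = F (\<Phi> \<omega>)) \<and> (AE \<omega> in M. V \<omega> = F (\<Psi> \<omega>)))"

lemma common_functionalI:
  assumes "F \<in> borel_measurable N" "AE \<omega> in M. U \<omega> = F (\<Phi> \<omega>)" "AE \<omega> in M. V \<omega> = F (\<Psi> \<omega>)"
  shows "common_functional M N \<Phi> \<Psi> U V"
  using assms by (auto simp: common_functional_def)

lemma common_functional_const: "common_functional M N \<Phi> \<Psi> (\<lambda>_. c) (\<lambda>_. c)"
  by (rule common_functionalI[where F = "\<lambda>_. c"]) auto

lemma common_functional_cong_AE:
  assumes "common_functional M N \<Phi> \<Psi> U V" "AE \<omega> in M. U' \<omega> = U \<omega>" "AE \<omega> in M. V' \<omega> = V \<omega>"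
  shows "common_functional M N \<Phi> \<Psi> U' V'"
proof -
  obtain F where F: "F \<in> borel_measurable N" "AE \<omega> in M. U \<omega> = F (\<Phi> \<omega>)" "AE \<omega> in M. V \<omega> = F (\<Psi> \<omega>)"
    using assms(1) by (auto simp: common_functional_def)
  show ?thesis
    by (rule common_functionalI[OF F(1)]) (use F(2,3) assms(2,3) in \<open>(eventually_elim, simp)+\<close>)
qed

lemma common_functional_add:
  assumes "common_functional M N \<Phi> \<Psi> U V" "common_functional M N \<Phi> \<Psi> U' V'"
  shows "common_functional M N \<Phi> \<Psi> (\<lambda>\<omega>. U \<omega> + U' \<omega>) (\<lambda>\<omega>. V \<omega> + V' \<omega>)"
proof -
  obtain F G where [measurable]: "F \<in> borel_measurable N" "G \<in> borel_measurable N"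
    and F: "AE \<omega> in M. U \<omega> = F (\<Phi> \<omega>)" "AE \<omega> in M. V \<omega> = F (\<Psi> \<omega>)"
    and G: "AE \<omega> in M. U' \<omega> = G (\<Phi> \<omega>)" "AE \<omega> in M. V' \<omega> = G (\<Psi> \<omega>)"
    using assms by (auto simp: common_functional_def)
  show ?thesis
    by (rule common_functionalI[where F = "\<lambda>x. F x + G x"])
      (measurable, use F G in \<open>(eventually_elim, simp)+\<close>)
qed

lemma common_functional_mult:
  assumes "common_functional M N \<Phi> \<Psi> U V" "common_functional M N \<Phi> \<Psi> U' V'"
  shows "common_functional M N \<Phi> \<Psi> (\<lambda>\<omega>. U \<omega> * U' \<omega>) (\<lambda>\<omega>. V \<omega> * V' \<omega>)"
proof -
  obtain F G where [measurable]: "F \<in> borel_measurable N" "G \<in> borel_measurable N"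
    and F: "AE \<omega> in M. U \<omega> = F (\<Phi> \<omega>)" "AE \<omega> in M. V \<omega> = F (\<Psi> \<omega>)"
    and G: "AE \<omega> in M. U' \<omega> = G (\<Phi> \<omega>)" "AE \<omega> in M. V' \<omega> = G (\<Psi> \<omega>)"
    using assms by (auto simp: common_functional_def)
  show ?thesis
    by (rule common_functionalI[where F = "\<lambda>x. F x * G x"])
      (measurable, use F G in \<open>(eventually_elim, simp)+\<close>)
qed

lemma common_functional_cmult:
  assumes "common_functional M N \<Phi> \<Psi> U V"
  shows "common_functional M N \<Phi> \<Psi> (\<lambda>\<omega>. c * U \<omega>) (\<lambda>\<omega>. c * V \<omega>)"
  by (intro common_functional_mult common_functional_const assms)

lemma common_functional_diff:
  assumes "common_functional M N \<Phi> \<Psi> U V" "common_functional M N \<Phi> \<Psi> U' V'"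
  shows "common_functional M N \<Phi> \<Psi> (\<lambda>\<omega>. U \<omega> - U' \<omega>) (\<lambda>\<omega>. V \<omega> - V' \<omega>)"
  using common_functional_add[OF assms(1) common_functional_cmult[OF assms(2), of "-1"]] by simp

lemma common_functional_sum:
  assumes "\<And>i. i \<in> I \<Longrightarrow> common_functional M N \<Phi> \<Psi> (U i) (V i)"
  shows "common_functional M N \<Phi> \<Psi> (\<lambda>\<omega>. \<Sum>i\<in>I. U i \<omega>) (\<lambda>\<omega>. \<Sum>i\<in>I. V i \<omega>)"
  using assms
proof (induction I rule: infinite_finite_induct)
  case (insert i I)
  then show ?case by (simp add: common_functional_add)
qed (simp_all add: common_functional_const)

text \<open>The functionals of the individual terms already serve both sides, so their pointwise
  \<open>lim\<close> does too. It is total and measurable; its value at paths without convergence is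
  met only on a null set.\<close>

lemma common_functional_lim:
  assumes "\<And>n. common_functional M N \<Phi> \<Psi> (U n) (V n)"
    and "AE \<omega> in M. (\<lambda>n. U n \<omega>) \<longlonglongrightarrow> U' \<omega>" "AE \<omega> in M. (\<lambda>n. V n \<omega>) \<longlonglongrightarrow> V' \<omega>"
  shows "common_functional M N \<Phi> \<Psi> U' V'"
proof -
  obtain F where [measurable]: "\<And>n. F n \<in> borel_measurable N"
    and F: "\<And>n. AE \<omega> in M. U n \<omega> = F n (\<Phi> \<omega>)" "\<And>n. AE \<omega> in M. V n \<omega> = F n (\<Psi> \<omega>)"
    using assms(1) unfolding common_functional_def Bex_def by metis
  \<comment> \<open>The exceptional null sets depend on \<open>n\<close>; countably many of them are
    merged.\<close>
  have F': "AE \<omega> in M. \<forall>n. U n \<omega> = F n (\<Phi> \<omega>)" "AE \<omega> in M. \<forall>n. V n \<omega> = F n (\<Psi> \<omega>)"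
    using F by (simp_all add: AE_all_countable)
  show ?thesis
    by (rule common_functionalI[where F = "\<lambda>x. lim (\<lambda>n. F n x)"])
      (measurable, use F' assms(2,3) in \<open>(eventually_elim, simp add: limI)+\<close>)
qed

text \<open>Transfer through the common law shows that the integral equals its own negative. Every
  equality in the chain is also valid for a non-integrable \<open>Z\<close>, where the Bochner
  integral is 0 by convention, so no moment bounds enter.\<close>

lemma integral_eq_0_if_common_functional_uminus:
  assumes [measurable]: "\<Phi> \<in> measurable M N" "\<Psi> \<in> measurable M N" "Z \<in> borel_measurable M"
    and law: "distr M N \<Phi> = distr M N \<Psi>"
    and Z: "common_functional M N \<Phi> \<Psi> Z (\<lambda>\<omega>. - Z \<omega>)"
  shows "(\<integral>\<omega>. Z \<omega> \<partial>M) = 0"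
proof -
  obtain F where [measurable]: "F \<in> borel_measurable N"
    and F: "AE \<omega> in M. Z \<omega> = F (\<Phi> \<omega>)" "AE \<omega> in M. - Z \<omega> = F (\<Psi> \<omega>)"
    using Z by (auto simp: common_functional_def)
  have "(\<integral>\<omega>. Z \<omega> \<partial>M) = (\<integral>\<omega>. F (\<Phi> \<omega>) \<partial>M)"
    by (rule integral_cong_AE) (use F in auto)
  also have "\<dots> = (\<integral>x. F x \<partial>distr M N \<Phi>)"
    by (simp add: integral_distr)
  also have "\<dots> = (\<integral>\<omega>. F (\<Psi> \<omega>) \<partial>M)"
    unfolding law by (simp add: integral_distr)
  also have "\<dots> = (\<integral>\<omega>. - Z \<omega> \<partial>M)"
    by (rule integral_cong_AE) (use F in auto)
  finally show ?thesis by simp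
qed

section \<open>Iterated integrals as functionals of the driving path\<close>

lemma partitions_nth_nonneg:
  assumes "ts \<in> partitions t" "k < length ts"
  shows "0 \<le> ts ! k"
proof -
  have "sorted ts" using assms(1) by (simp add: partitions_def strict_sorted_imp_sorted)
  then have "ts ! 0 \<le> ts ! k" using assms(2) by (simp add: sorted_nth_mono)
  then show ?thesis using assms by (auto simp: partitions_def simp flip: hd_conv_nth)
qed

text \<open>Both kinds of sum are bilinear in integrand and integrator, so the factors
  \<open>a\<close> and \<open>b\<close> multiply. Only finitely many sampling times occur, all
  nonnegative.\<close>

lemma common_functional_riemann_sum:
  assumes ts: "ts \<in> partitions t"
    and H: "\<And>s. s \<ge> 0 \<Longrightarrow> common_functional M N \<Phi> \<Psi> (H s) (\<lambda>\<omega>. a * H s \<omega>)"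
    and X: "\<And>s. s \<ge> 0 \<Longrightarrow> common_functional M N \<Phi> \<Psi> (X s) (\<lambda>\<omega>. b * X s \<omega>)"
  shows "common_functional M N \<Phi> \<Psi> (riemann_sum c H X ts) (\<lambda>\<omega>. a * b * riemann_sum c H X ts \<omega>)"
proof -
  have H': "common_functional M N \<Phi> \<Psi> (H (ts ! k)) (\<lambda>\<omega>. a * H (ts ! k) \<omega>)"
    and X': "common_functional M N \<Phi> \<Psi> (X (ts ! k)) (\<lambda>\<omega>. b * X (ts ! k) \<omega>)"
    if "k < length ts" for k
    using that partitions_nth_nonneg[OF ts] H X by auto
  show ?thesis
  proof (cases c)
    case Ito
    have "common_functional M N \<Phi> \<Psi>
       (\<lambda>\<omega>. \<Sum>k<length ts - 1. H (ts ! k) \<omega> * (X (ts ! Suc k) \<omega> - X (ts ! k) \<omega>))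
       (\<lambda>\<omega>. \<Sum>k<length ts - 1. a * H (ts ! k) \<omega> * (b * X (ts ! Suc k) \<omega> - b * X (ts ! k) \<omega>))"
      by (intro common_functional_sum common_functional_mult common_functional_diff H' X') auto
    then show ?thesis
      using Ito by (auto elim!: common_functional_cong_AE simp: sum_distrib_left algebra_simps)
  next
    case Stratonovich
    \<comment> \<open>The average is written as a constant multiple instead of a quotient, so that
      closure under constant factors applies to it as a single integrand.\<close>
    have "common_functional M N \<Phi> \<Psi>
       (\<lambda>\<omega>. \<Sum>k<length ts - 1. (1 / 2 * (H (ts ! k) \<omega> + H (ts ! Suc k) \<omega>)) *
          (X (ts ! Suc k) \<omega> - X (ts ! k) \<omega>))
       (\<lambda>\<omega>. \<Sum>k<length ts - 1. (1 / 2 * (a * H (ts ! k) \<omega> + a * H (ts ! Suc k) \<omega>)) *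
          (b * X (ts ! Suc k) \<omega> - b * X (ts ! k) \<omega>))"
      by (intro common_functional_sum common_functional_mult[where U = "\<lambda>\<omega>. 1 / 2 * (_ \<omega> + _ \<omega>)"]
          common_functional_cmult common_functional_add common_functional_diff H' X') auto
    then show ?thesis
    proof (rule common_functional_cong_AE)
      show "AE \<omega> in M. riemann_sum c H X ts \<omega> = (\<Sum>k<length ts - 1.
          (1 / 2 * (H (ts ! k) \<omega> + H (ts ! Suc k) \<omega>)) * (X (ts ! Suc k) \<omega> - X (ts ! k) \<omega>))"
        using Stratonovich by simp
      show "AE \<omega> in M. a * b * riemann_sum c H X ts \<omega> = (\<Sum>k<length ts - 1.
          (1 / 2 * (a * H (ts ! k) \<omega> + a * H (ts ! Suc k) \<omega>)) *
          (b * X (ts ! Suc k) \<omega> - b * X (ts ! k) \<omega>))"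
        using Stratonovich
        by (auto simp: sum_distrib_left intro!: sum.cong) (simp add: algebra_simps)
    qed
  qed
qed

lemma signature_measurable:
  assumes "is_signature M c X S" "t \<ge> 0"
  shows "S w t \<in> borel_measurable M"
proof (cases w rule: rev_cases)
  case Nil
  then have "S w t \<in> borel_measurable M \<longleftrightarrow> (\<lambda>_. 1 :: real) \<in> borel_measurable M"
    using assms by (intro measurable_cong) (auto simp: is_signature_def)
  then show ?thesis by simp
next
  case (snoc v i)
  then show ?thesis using assms by (auto simp: is_signature_def has_stochastic_integral_def)
qed

text \<open>Each appended letter is the integrator of one more integral and contributes one factor
  -1. The induction keeps \<open>t\<close> arbitrary because the sums for \<open>w @ [i]\<close> at
  time \<open>t\<close> sample \<open>S w\<close> at earlier times. The almost surely convergent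
  sequence chosen for the original sums also handles the signed ones.\<close>

lemma common_functional_signature:
  fixes X :: "real \<Rightarrow> 'a \<Rightarrow> real^'d"
  assumes M: "prob_space M" and S: "is_signature M c X S"
    and meas: "\<And>i s. s \<ge> 0 \<Longrightarrow> (\<lambda>\<omega>. vec_nth (X s \<omega>) i) \<in> borel_measurable M"
    and X: "\<And>i s. s \<ge> 0 \<Longrightarrow>
      common_functional M N \<Phi> \<Psi> (\<lambda>\<omega>. vec_nth (X s \<omega>) i) (\<lambda>\<omega>. - vec_nth (X s \<omega>) i)"
    and "t \<ge> 0"
  shows "common_functional M N \<Phi> \<Psi> (S w t) (\<lambda>\<omega>. (- 1) ^ length w * S w t \<omega>)"
  using \<open>t \<ge> 0\<close>
proof (induction w arbitrary: t rule: rev_induct)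
  case Nil
  then have "AE \<omega> in M. S [] t \<omega> = 1"
    using S by (auto simp: is_signature_def)
  then show ?case
    by (intro common_functional_cong_AE[OF common_functional_const[where c = 1]]) auto
next
  case (snoc i w)
  have I: "has_stochastic_integral M c (S w) (\<lambda>s \<omega>. vec_nth (X s \<omega>) i) t (S (w @ [i]) t)"
    using S snoc.prems by (auto simp: is_signature_def)
  have part: "eventually (\<lambda>ts. ts \<in> partitions t) (mesh_to_0 t)"
    unfolding mesh_to_0_def by (rule eventually_INF1[of 1]) (auto simp: eventually_principal)
  let ?R = "riemann_sum c (S w) (\<lambda>s \<omega>. vec_nth (X s \<omega>) i)"
  obtain ts where ts: "\<And>n. ts n \<in> partitions t"
    and lim: "AE \<omega> in M. (\<lambda>n. ?R (ts n) \<omega>) \<longlonglongrightarrow> S (w @ [i]) t \<omega>"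
  proof (rule tendsto_in_probability_AE_subseq[OF M mesh_to_0_neq_bot[OF snoc.prems] _ part])
    show "tendsto_in_probability M ?R (S (w @ [i]) t) (mesh_to_0 t)"
      using I by (simp add: has_stochastic_integral_def)
    show "?R us \<in> borel_measurable M" if "us \<in> partitions t" for us
      using that by (rule riemann_sum_measurable) (auto intro: signature_measurable[OF S] meas)
    show "S (w @ [i]) t \<in> borel_measurable M"
      using S snoc.prems by (rule signature_measurable)
  qed blast
  have "common_functional M N \<Phi> \<Psi> (?R (ts n)) (\<lambda>\<omega>. (- 1) ^ length w * (- 1) * ?R (ts n) \<omega>)" for n
    by (intro common_functional_riemann_sum[OF ts] snoc.IH) (use X in auto)
  then show ?case
  proof (rule common_functional_lim[OF _ lim])
    show "AE \<omega> in M. (\<lambda>n. (- 1) ^ length w * (- 1) * ?R (ts n) \<omega>)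
        \<longlonglongrightarrow> (- 1) ^ length (w @ [i]) * S (w @ [i]) t \<omega>"
      using lim by eventually_elim (auto intro!: tendsto_intros)
  qed
qed

section \<open>Symmetry of the law of Brownian motion and of the Ornstein-Uhlenbeck process\<close>

abbreviation path_space :: "(real \<Rightarrow> real) measure" where
  "path_space \<equiv> Pi\<^sub>M {0..} (\<lambda>_. borel)"

text \<open>Symmetry is stated on the product sigma-algebra over all nonnegative times. This keeps
  it checkable on finite-dimensional marginals, while limits of countably many functionals remain
  measurable.\<close>

definition symmetric_process :: "'a measure \<Rightarrow> (real \<Rightarrow> 'a \<Rightarrow> real) \<Rightarrow> bool" where
  "symmetric_process M A \<longleftrightarrow>
     distr M path_space (\<lambda>\<omega>. \<lambda>t\<in>{0..}. A t \<omega>) = distr M path_space (\<lambda>\<omega>. \<lambda>t\<in>{0..}. - A t \<omega>)"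

text \<open>Cylinder sets over finite boxes form an intersection-stable generator of the product
  sigma-algebra, so finite-dimensional marginals determine the law of a process.\<close>

lemma distr_restrict_eqI:
  fixes A B :: "'t \<Rightarrow> 'a \<Rightarrow> real"
  assumes "prob_space M"
    and A: "\<And>t. t \<in> T \<Longrightarrow> A t \<in> borel_measurable M"
    and B: "\<And>t. t \<in> T \<Longrightarrow> B t \<in> borel_measurable M"
    and fdd: "\<And>J. finite J \<Longrightarrow> J \<subseteq> T \<Longrightarrow>
       distr M (Pi\<^sub>M J (\<lambda>_. borel)) (\<lambda>\<omega>. \<lambda>t\<in>J. A t \<omega>) = distr M (Pi\<^sub>M J (\<lambda>_. borel)) (\<lambda>\<omega>. \<lambda>t\<in>J. B t \<omega>)"
  shows "distr M (Pi\<^sub>M T (\<lambda>_. borel)) (\<lambda>\<omega>. \<lambda>t\<in>T. A t \<omega>) = distr M (Pi\<^sub>M T (\<lambda>_. borel)) (\<lambda>\<omega>. \<lambda>t\<in>T. B t \<omega>)"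
proof (rule measure_eqI_PiM_infinite)
  interpret prob_space M by fact
  fix E :: "'t \<Rightarrow> real set" and J
  assume J: "finite J" "J \<subseteq> T" and E: "\<And>i. i \<in> J \<Longrightarrow> E i \<in> sets borel"
  have box: "Pi\<^sub>E J E \<in> sets (Pi\<^sub>M J (\<lambda>_. borel))"
    using J E by (intro sets_PiM_I_finite) auto
  have *: "emeasure (distr M (Pi\<^sub>M T (\<lambda>_. borel)) (\<lambda>\<omega>. \<lambda>t\<in>T. C t \<omega>)) (prod_emb T (\<lambda>_. borel) J (Pi\<^sub>E J E))
      = emeasure (distr M (Pi\<^sub>M J (\<lambda>_. borel)) (\<lambda>\<omega>. \<lambda>t\<in>J. C t \<omega>)) (Pi\<^sub>E J E)"
    if C: "\<And>t. t \<in> T \<Longrightarrow> C t \<in> borel_measurable M" for C :: "'t \<Rightarrow> 'a \<Rightarrow> real"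
  proof -
    have "(\<lambda>\<omega>. \<lambda>t\<in>T. C t \<omega>) \<in> measurable M (Pi\<^sub>M T (\<lambda>_. borel))"
      using C by (intro measurable_restrict) auto
    moreover have "(\<lambda>\<omega>. \<lambda>t\<in>J. C t \<omega>) \<in> measurable M (Pi\<^sub>M J (\<lambda>_. borel))"
      using C J by (intro measurable_restrict) auto
    moreover have "prod_emb T (\<lambda>_. borel) J (Pi\<^sub>E J E) \<in> sets (Pi\<^sub>M T (\<lambda>_. borel))"
      using J E by (intro sets_PiM_I) auto
    moreover have "(\<lambda>\<omega>. \<lambda>t\<in>T. C t \<omega>) -` prod_emb T (\<lambda>_. borel) J (Pi\<^sub>E J E) \<inter> space M
        = (\<lambda>\<omega>. \<lambda>t\<in>J. C t \<omega>) -` Pi\<^sub>E J E \<inter> space M"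
      using J by (auto simp: prod_emb_def PiE_iff restrict_def extensional_def subset_eq)
    ultimately show ?thesis using box by (simp add: emeasure_distr)
  qed
  show "emeasure (distr M (Pi\<^sub>M T (\<lambda>_. borel)) (\<lambda>\<omega>. \<lambda>t\<in>T. A t \<omega>)) (prod_emb T (\<lambda>_. borel) J (Pi\<^sub>E J E))
      = emeasure (distr M (Pi\<^sub>M T (\<lambda>_. borel)) (\<lambda>\<omega>. \<lambda>t\<in>T. B t \<omega>)) (prod_emb T (\<lambda>_. borel) J (Pi\<^sub>E J E))"
    using fdd[OF J] by (simp add: *[OF A] *[OF B])
next
  interpret prob_space M by fact
  show "finite_measure (distr M (Pi\<^sub>M T (\<lambda>_. borel)) (\<lambda>\<omega>. \<lambda>t\<in>T. A t \<omega>))"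
    using A by (intro finite_measure_distr measurable_restrict) auto
qed simp_all

lemma (in prob_space) distr_indep_vars_uminus:
  fixes D :: "'i \<Rightarrow> 'a \<Rightarrow> real"
  assumes indep: "indep_vars (\<lambda>_. borel) D I"
    and sym: "\<And>i. i \<in> I \<Longrightarrow> distr M borel (D i) = distr M borel (\<lambda>\<omega>. - D i \<omega>)"
  shows "distr M (Pi\<^sub>M I (\<lambda>_. borel)) (\<lambda>\<omega>. \<lambda>i\<in>I. D i \<omega>) = distr M (Pi\<^sub>M I (\<lambda>_. borel)) (\<lambda>\<omega>. \<lambda>i\<in>I. - D i \<omega>)"
\<comment> \<open>The product characterization of independence is applied to nonempty families only.
  The empty family does occur later, as the increments of a grid consisting of time 0 alone.\<close>
proof (cases "I = {}")
  case False
  have D: "D i \<in> borel_measurable M" if "i \<in> I" for i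
    using indep that by (simp add: indep_vars_def)
  have indep': "indep_vars (\<lambda>_. borel) (\<lambda>i \<omega>. - D i \<omega>) I"
    by (rule indep_vars_compose2[OF indep]) simp
  have "distr M (Pi\<^sub>M I (\<lambda>_. borel)) (\<lambda>\<omega>. \<lambda>i\<in>I. D i \<omega>) = Pi\<^sub>M I (\<lambda>i. distr M borel (D i))"
    using indep False D by (simp add: indep_vars_iff_distr_eq_PiM')
  also have "\<dots> = Pi\<^sub>M I (\<lambda>i. distr M borel (\<lambda>\<omega>. - D i \<omega>))"
    by (rule PiM_cong) (use sym in auto)
  also have "\<dots> = distr M (Pi\<^sub>M I (\<lambda>_. borel)) (\<lambda>\<omega>. \<lambda>i\<in>I. - D i \<omega>)"
    using indep' False D by (subst (asm) indep_vars_iff_distr_eq_PiM') auto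
  finally show ?thesis .
qed (simp add: restrict_def)

lemma standard_brownian_motion_increment_symmetric:
  assumes "prob_space M" "standard_brownian_motion M W" "0 \<le> s" "s < t"
  shows "distr M borel (\<lambda>\<omega>. W t \<omega> - W s \<omega>) = distr M borel (\<lambda>\<omega>. - (W t \<omega> - W s \<omega>))"
proof -
  interpret prob_space M by fact
  have D: "distributed M lborel (\<lambda>\<omega>. W t \<omega> - W s \<omega>) (normal_density 0 (sqrt (t - s)))"
    using assms by (simp add: standard_brownian_motion_def)
  then have "distributed M lborel (\<lambda>\<omega>. 0 + (- 1) * (W t \<omega> - W s \<omega>))
      (normal_density (0 + (- 1) * 0) (\<bar>- 1\<bar> * sqrt (t - s)))"
    using \<open>s < t\<close> by (intro normal_density_affine) auto
  then have "distr M lborel (\<lambda>\<omega>. W t \<omega> - W s \<omega>) = distr M lborel (\<lambda>\<omega>. - (W t \<omega> - W s \<omega>))"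
    using D by (simp add: distributed_def)
  \<comment> \<open>Densities are stated relative to \<open>lborel\<close>; as a target space only
    its sigma-algebra matters, and that is the Borel one.\<close>
  moreover have "distr M borel f = distr M lborel f" for f :: "'a \<Rightarrow> real"
    by (rule distr_cong) auto
  ultimately show ?thesis by metis
qed

text \<open>The values at finitely many times are partial sums of independent centred Gaussian
  increments. The vector of increments is symmetric, and summation is linear, hence commutes with
  negation.\<close>

lemma symmetric_process_brownian_motion:
  assumes M: "prob_space M" and W: "standard_brownian_motion M W"
  shows "symmetric_process M W"
  unfolding symmetric_process_def
proof (rule distr_restrict_eqI[OF M])
  interpret prob_space M by fact
  have meas: "W t \<in> borel_measurable M" if "t \<ge> 0" for t
    using W that by (simp add: standard_brownian_motion_def)
  then show "W t \<in> borel_measurable M" "(\<lambda>\<omega>. - W t \<omega>) \<in> borel_measurable M" if "t \<in> {0..}" for t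
    using that by auto
  have W0: "AE \<omega> in M. W 0 \<omega> = 0"
    using W by (simp add: standard_brownian_motion_def)
  fix J :: "real set"
  assume J: "finite J" "J \<subseteq> {0..}"
  \<comment> \<open>Time 0 is added to the grid so that the partial sums telescope down to
    \<open>W 0\<close>, which is almost surely 0.\<close>
  define l where "l = sorted_list_of_set (insert 0 J)"
  define n where "n = length l - 1"
  define D where "D k \<omega> = W (l ! Suc k) \<omega> - W (l ! k) \<omega>" for k \<omega>
  have set_l: "set l = insert 0 J" and sorted_l: "sorted_wrt (<) l"
    unfolding l_def using J set_sorted_list_of_set[of "insert 0 J"]
      strict_sorted_list_of_set[of "insert 0 J"] by (simp_all del: sorted_list_of_set_insert_remove)
  then have "l \<noteq> []" by auto
  then have len: "length l = Suc n" by (simp add: n_def)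
  have l0: "l ! 0 = 0"
  proof -
    obtain i where i: "i < length l" "l ! i = 0" using set_l by (metis in_set_conv_nth insertI1)
    have "l ! 0 \<in> set l" using len by simp
    then have "l ! 0 \<ge> 0" using J set_l by auto
    moreover have "l ! 0 \<le> l ! i"
      using sorted_l i by (intro sorted_nth_mono strict_sorted_imp_sorted) auto
    ultimately show ?thesis using i by simp
  qed
  have step: "l ! k < l ! Suc k" if "k < n" for k
    using sorted_l that len by (auto intro: sorted_wrt_nth_less)
  have nonneg: "l ! k \<ge> 0" if "k \<le> n" for k
    using that J set_l len nth_mem[of k l] by auto
  have indep: "indep_vars (\<lambda>_. borel) D {..<n}"
    using W step l0 unfolding standard_brownian_motion_def D_def by auto
  have D[measurable]: "D k \<in> borel_measurable M" if "k \<in> {..<n}" for k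
    unfolding D_def using that by (intro borel_measurable_diff meas nonneg) auto
  have law: "distr M (Pi\<^sub>M {..<n} (\<lambda>_. borel)) (\<lambda>\<omega>. \<lambda>k\<in>{..<n}. D k \<omega>)
      = distr M (Pi\<^sub>M {..<n} (\<lambda>_. borel)) (\<lambda>\<omega>. \<lambda>k\<in>{..<n}. - D k \<omega>)"
    by (rule distr_indep_vars_uminus[OF indep])
      (use standard_brownian_motion_increment_symmetric[OF M W] nonneg step in \<open>simp_all add: D_def[abs_def]\<close>)
  have "\<forall>t\<in>J. \<exists>k\<le>n. l ! k = t"
    using set_l len by (metis in_set_conv_nth insertCI less_Suc_eq_le)
  then obtain idx where idx: "\<And>t. t \<in> J \<Longrightarrow> idx t \<le> n" "\<And>t. t \<in> J \<Longrightarrow> l ! idx t = t"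
    by metis
  \<comment> \<open>The summation map from increments to values: \<open>idx t\<close> is the
    position of \<open>t\<close> in the grid, so the increments before it add up to
    \<open>W t - W 0\<close>.\<close>
  define G :: "(nat \<Rightarrow> real) \<Rightarrow> real \<Rightarrow> real" where "G x = (\<lambda>t\<in>J. \<Sum>k<idx t. x k)" for x
  have G[measurable]: "G \<in> measurable (Pi\<^sub>M {..<n} (\<lambda>_. borel)) (Pi\<^sub>M J (\<lambda>_. borel))"
    unfolding G_def
    by (intro measurable_restrict borel_measurable_sum measurable_component_singleton)
      (use idx(1) in fastforce)
  have tel: "(\<Sum>k<m. D k \<omega>) = W (l ! m) \<omega> - W 0 \<omega>" for m \<omega>
    using sum_lessThan_telescope[of "\<lambda>k. W (l ! k) \<omega>" m] by (simp add: D_def l0)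
  have mem: "k < n" if "t \<in> J" "k < idx t" for k t using idx(1)[of t] that by simp
  have WG: "AE \<omega> in M. (\<lambda>t\<in>J. W t \<omega>) = G (\<lambda>k\<in>{..<n}. D k \<omega>)"
    using W0
  proof eventually_elim
    case (elim \<omega>)
    show ?case
      using tel[of \<omega>] idx(2) elim mem by (auto simp: G_def fun_eq_iff restrict_def)
  qed
  have WG': "AE \<omega> in M. (\<lambda>t\<in>J. - W t \<omega>) = G (\<lambda>k\<in>{..<n}. - D k \<omega>)"
    using W0
  proof eventually_elim
    case (elim \<omega>)
    show ?case
      using tel[of \<omega>] idx(2) elim mem by (auto simp: G_def fun_eq_iff restrict_def sum_negf)
  qed
  have mJ: "(\<lambda>\<omega>. \<lambda>t\<in>J. W t \<omega>) \<in> measurable M (Pi\<^sub>M J (\<lambda>_. borel))"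
    "(\<lambda>\<omega>. \<lambda>t\<in>J. - W t \<omega>) \<in> measurable M (Pi\<^sub>M J (\<lambda>_. borel))"
    using J(2) meas by (auto intro!: measurable_restrict)
  have mD[measurable]: "(\<lambda>\<omega>. \<lambda>k\<in>{..<n}. D k \<omega>) \<in> measurable M (Pi\<^sub>M {..<n} (\<lambda>_. borel))"
    "(\<lambda>\<omega>. \<lambda>k\<in>{..<n}. - D k \<omega>) \<in> measurable M (Pi\<^sub>M {..<n} (\<lambda>_. borel))"
    by (auto intro!: measurable_restrict borel_measurable_uminus D)
  have "distr M (Pi\<^sub>M J (\<lambda>_. borel)) (\<lambda>\<omega>. \<lambda>t\<in>J. W t \<omega>)
      = distr M (Pi\<^sub>M J (\<lambda>_. borel)) (\<lambda>\<omega>. G (\<lambda>k\<in>{..<n}. D k \<omega>))"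
    by (rule distr_cong_AE[OF refl refl WG mJ(1)]) (rule measurable_compose[OF mD(1) G])
  also have "\<dots> = distr (distr M (Pi\<^sub>M {..<n} (\<lambda>_. borel)) (\<lambda>\<omega>. \<lambda>k\<in>{..<n}. D k \<omega>)) (Pi\<^sub>M J (\<lambda>_. borel)) G"
    by (subst distr_distr[OF G mD(1)]) (simp add: o_def)
  also have "\<dots> = distr M (Pi\<^sub>M J (\<lambda>_. borel)) (\<lambda>\<omega>. G (\<lambda>k\<in>{..<n}. - D k \<omega>))"
    unfolding law by (subst distr_distr[OF G mD(2)]) (simp add: o_def)
  also have "\<dots> = distr M (Pi\<^sub>M J (\<lambda>_. borel)) (\<lambda>\<omega>. \<lambda>t\<in>J. - W t \<omega>)"
    by (rule distr_cong_AE[OF refl refl _ measurable_compose[OF mD(2) G] mJ(2)])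
      (use WG' in auto)
  finally show "distr M (Pi\<^sub>M J (\<lambda>_. borel)) (\<lambda>\<omega>. \<lambda>t\<in>J. W t \<omega>)
      = distr M (Pi\<^sub>M J (\<lambda>_. borel)) (\<lambda>\<omega>. \<lambda>t\<in>J. - W t \<omega>)" .
qed

lemma path_measurable:
  fixes A :: "real \<Rightarrow> 'a \<Rightarrow> real"
  assumes "\<And>t. t \<ge> 0 \<Longrightarrow> A t \<in> borel_measurable M"
  shows "(\<lambda>\<omega>. \<lambda>t\<in>{0..}. A t \<omega>) \<in> measurable M path_space"
    and "(\<lambda>\<omega>. \<lambda>t\<in>{0..}. - A t \<omega>) \<in> measurable M path_space"
  using assms by (auto intro!: measurable_restrict)

text \<open>An odd functional of a symmetric process is symmetric. A separate functional is chosen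
  for each time, each with its own null set; this is harmless because only finitely many times are
  compared at once.\<close>

lemma symmetric_process_common_functional:
  fixes A B :: "real \<Rightarrow> 'a \<Rightarrow> real"
  assumes M: "prob_space M"
    and A: "\<And>t. t \<ge> 0 \<Longrightarrow> A t \<in> borel_measurable M" and sym: "symmetric_process M A"
    and B: "\<And>t. t \<ge> 0 \<Longrightarrow> B t \<in> borel_measurable M"
    and AB: "\<And>t. t \<ge> 0 \<Longrightarrow> common_functional M path_space
       (\<lambda>\<omega>. \<lambda>t\<in>{0..}. A t \<omega>) (\<lambda>\<omega>. \<lambda>t\<in>{0..}. - A t \<omega>) (B t) (\<lambda>\<omega>. - B t \<omega>)"
  shows "symmetric_process M B"
  unfolding symmetric_process_def
proof (rule distr_restrict_eqI[OF M])
  interpret prob_space M by fact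
  let ?\<Phi> = "\<lambda>\<omega>. \<lambda>t\<in>{0..}. A t \<omega>" and ?\<Psi> = "\<lambda>\<omega>. \<lambda>t\<in>{0..}. - A t \<omega>"
  show "B t \<in> borel_measurable M" "(\<lambda>\<omega>. - B t \<omega>) \<in> borel_measurable M" if "t \<in> {0..}" for t
    using that B by auto
  have "\<forall>t\<in>{0..}. \<exists>F. F \<in> borel_measurable path_space \<and>
      (AE \<omega> in M. B t \<omega> = F (?\<Phi> \<omega>)) \<and> (AE \<omega> in M. - B t \<omega> = F (?\<Psi> \<omega>))"
    using AB by (auto simp: common_functional_def)
  from bchoice[OF this] obtain F where F: "\<And>t. t \<ge> 0 \<Longrightarrow> F t \<in> borel_measurable path_space"
    "\<And>t. t \<ge> 0 \<Longrightarrow> AE \<omega> in M. B t \<omega> = F t (?\<Phi> \<omega>)"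
    "\<And>t. t \<ge> 0 \<Longrightarrow> AE \<omega> in M. - B t \<omega> = F t (?\<Psi> \<omega>)"
    by auto
  fix J :: "real set"
  assume J: "finite J" "J \<subseteq> {0..}"
  let ?N = "Pi\<^sub>M J (\<lambda>_. borel) :: (real \<Rightarrow> real) measure"
  let ?G = "\<lambda>x. \<lambda>t\<in>J. F t x"
  have G: "?G \<in> measurable path_space ?N"
    using J F(1) by (intro measurable_restrict) auto
  have BG: "AE \<omega> in M. (\<lambda>t\<in>J. B t \<omega>) = ?G (?\<Phi> \<omega>)"
  proof -
    have "AE \<omega> in M. \<forall>t\<in>J. B t \<omega> = F t (?\<Phi> \<omega>)"
      using J F(2) by (intro AE_finite_allI) auto
    then show ?thesis by eventually_elim (auto simp: restrict_def fun_eq_iff)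
  qed
  have BG': "AE \<omega> in M. ?G (?\<Psi> \<omega>) = (\<lambda>t\<in>J. - B t \<omega>)"
  proof -
    have "AE \<omega> in M. \<forall>t\<in>J. - B t \<omega> = F t (?\<Psi> \<omega>)"
      using J F(3) by (intro AE_finite_allI) auto
    then show ?thesis by eventually_elim (auto simp: restrict_def fun_eq_iff)
  qed
  have mJ: "(\<lambda>\<omega>. \<lambda>t\<in>J. B t \<omega>) \<in> measurable M ?N" "(\<lambda>\<omega>. \<lambda>t\<in>J. - B t \<omega>) \<in> measurable M ?N"
    using J(2) B by (auto intro!: measurable_restrict)
  note mA = path_measurable[OF A]
  have "distr M ?N (\<lambda>\<omega>. \<lambda>t\<in>J. B t \<omega>) = distr M ?N (\<lambda>\<omega>. ?G (?\<Phi> \<omega>))"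
    by (rule distr_cong_AE[OF refl refl BG mJ(1) measurable_compose[OF mA(1) G]])
  also have "\<dots> = distr (distr M path_space ?\<Phi>) ?N ?G"
    by (subst distr_distr[OF G mA(1)]) (simp_all add: o_def)
  also have "\<dots> = distr M ?N (\<lambda>\<omega>. ?G (?\<Psi> \<omega>))"
    unfolding sym[unfolded symmetric_process_def] by (subst distr_distr[OF G mA(2)]) (simp_all add: o_def)
  also have "\<dots> = distr M ?N (\<lambda>\<omega>. \<lambda>t\<in>J. - B t \<omega>)"
    by (rule distr_cong_AE[OF refl refl BG' measurable_compose[OF mA(2) G] mJ(2)])
  finally show "distr M ?N (\<lambda>\<omega>. \<lambda>t\<in>J. B t \<omega>) = distr M ?N (\<lambda>\<omega>. \<lambda>t\<in>J. - B t \<omega>)" .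
qed

section \<open>The OU process as a functional of its driving Brownian motion\<close>

text \<open>Equidistant left-point sums exhibit the time integral of a continuous path as a limit of
  functionals of finitely many coordinates, which is what makes it measurable on path space.\<close>

lemma riemann_sums_tendsto_integral:
  fixes f :: "real \<Rightarrow> real"
  assumes "t \<ge> 0" and cont: "continuous_on {0..t} f"
  shows "(\<lambda>n. \<Sum>k<Suc n. t / real (Suc n) * f (t * real k / real (Suc n))) \<longlonglongrightarrow> integral {0..t} f"
proof (cases "t = 0")
  case False
  with \<open>t \<ge> 0\<close> have t: "t > 0" by simp
  define p where "p n k = t * real k / real (Suc n)" for n k
  have p: "p n k \<le> p n (Suc k)" "p n (Suc k) - p n k = t / real (Suc n)" "0 \<le> p n k"
    "p n (Suc n) = t" "p n 0 = 0" "k \<le> Suc n \<Longrightarrow> p n k \<le> t" for n k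
  proof -
    have le: "p n i \<le> p n j" if "i \<le> j" for i j
      unfolding p_def using t that by (intro divide_right_mono mult_left_mono) auto
    show "p n k \<le> p n (Suc k)" by (rule le) simp
    show "p n (Suc k) - p n k = t / real (Suc n)"
      by (simp add: p_def algebra_simps flip: diff_divide_distrib)
    show "0 \<le> p n k" "p n 0 = 0" using t by (simp_all add: p_def)
    show "p n (Suc n) = t" unfolding p_def by (rule nonzero_mult_div_cancel_right) simp
    then show "k \<le> Suc n \<Longrightarrow> p n k \<le> t" using le by metis
  qed
  have int: "f integrable_on {a..b}" if "0 \<le> a" "b \<le> t" for a b
    using that by (intro integrable_continuous_real continuous_on_subset[OF cont]) auto
  have split: "integral {0..p n m} f = (\<Sum>k<m. integral {p n k..p n (Suc k)} f)" if "m \<le> Suc n" for n m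
    using that
  proof (induction m)
    case (Suc m)
    have "integral {0..p n m} f + integral {p n m..p n (Suc m)} f = integral {0..p n (Suc m)} f"
      by (rule Henstock_Kurzweil_Integration.integral_combine) (use p int Suc.prems in auto)
    then show ?case using Suc by simp
  qed (simp add: p)
  show ?thesis
  proof (rule LIMSEQ_I)
    fix e :: real assume "e > 0"
    \<comment> \<open>The errors on the subintervals add up to \<open>e' * t\<close>, which is half
      of \<open>e\<close>.\<close>
    define e' where "e' = e / (2 * t)"
    have "e' > 0" using \<open>e > 0\<close> t by (simp add: e'_def)
    have "uniformly_continuous_on {0..t} f"
      using cont by (rule compact_uniformly_continuous) simp
    then obtain d where d: "d > 0"
      "\<And>x y. x \<in> {0..t} \<Longrightarrow> y \<in> {0..t} \<Longrightarrow> \<bar>y - x\<bar> < d \<Longrightarrow> \<bar>f y - f x\<bar> < e'"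
      using \<open>e' > 0\<close> unfolding uniformly_continuous_on_def dist_real_def by metis
    obtain n0 :: nat where n0: "t / d < real n0" using reals_Archimedean2 by blast
    have "norm ((\<Sum>k<Suc n. t / real (Suc n) * f (p n k)) - integral {0..t} f) < e" if "n \<ge> n0" for n
    proof -
      have mesh: "t / real (Suc n) < d"
      proof -
        have "t / d < real (Suc n)" using n0 that by linarith
        then show ?thesis using d(1) by (simp add: field_simps)
      qed
      have piece: "\<bar>t / real (Suc n) * f (p n k) - integral {p n k..p n (Suc k)} f\<bar> \<le> e' * (t / real (Suc n))"
        if "k < Suc n" for k
      proof -
        have sub: "x \<in> {0..t}" if "x \<in> {p n k..p n (Suc k)}" for x
          using that p(3)[of n k] p(6)[of "Suc k" n] \<open>k < Suc n\<close> by auto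
        have intf: "f integrable_on {p n k..p n (Suc k)}"
          using \<open>k < Suc n\<close> p by (intro int) auto
        have "t / real (Suc n) * f (p n k) - integral {p n k..p n (Suc k)} f
            = integral {p n k..p n (Suc k)} (\<lambda>x. f (p n k) - f x)"
          using intf p(1)[of n k] p(2)[of n k]
          by (subst Henstock_Kurzweil_Integration.integral_diff) auto
        moreover have "norm (integral {p n k..p n (Suc k)} (\<lambda>x. f (p n k) - f x)) \<le> e' * (p n (Suc k) - p n k)"
        proof (rule integral_bound)
          show "continuous_on {p n k..p n (Suc k)} (\<lambda>x. f (p n k) - f x)"
            by (intro continuous_intros continuous_on_subset[OF cont]) (use sub in auto)
          fix x assume x: "x \<in> {p n k..p n (Suc k)}"
          show "norm (f (p n k) - f x) \<le> e'"
            using d(2)[of x "p n k"] sub[OF x] sub[of "p n k"] x p(1,2)[of n k] mesh by fastforce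
        qed (rule p)
        ultimately show ?thesis using p(2) by simp
      qed
      have "\<bar>(\<Sum>k<Suc n. t / real (Suc n) * f (p n k)) - integral {0..t} f\<bar>
          = \<bar>\<Sum>k<Suc n. t / real (Suc n) * f (p n k) - integral {p n k..p n (Suc k)} f\<bar>"
        using split[of "Suc n" n] p(4)[of n] by (simp add: sum_subtractf del: sum.lessThan_Suc)
      also have "\<dots> \<le> (\<Sum>k<Suc n. e' * (t / real (Suc n)))"
        by (rule order_trans[OF sum_abs sum_mono]) (use piece in auto)
      also have "\<dots> = e' * t" by simp
      also have "\<dots> < e" using \<open>e > 0\<close> t by (simp add: e'_def)
      finally show ?thesis by simp
    qed
    then show "\<exists>n0. \<forall>n\<ge>n0. norm ((\<Sum>k<Suc n. t / real (Suc n) * f (t * real k / real (Suc n))) - integral {0..t} f) < e"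
      unfolding p_def by blast
  qed
qed simp

text \<open>Variation of constants for I(s), the integral of \<open>y\<close> over [0, s]: it
  satisfies I' = -\<kappa> I + w, so exp(\<kappa> s) I(s) has derivative exp(\<kappa> s) w(s).
  Solving for I(t) and inserting it into the equation gives the formula. Only continuity of
  \<open>w\<close> is used, so it applies to Brownian paths.\<close>

lemma linear_integral_equation_solution:
  fixes y w :: "real \<Rightarrow> real"
  assumes "t \<ge> 0" and y: "continuous_on {0..t} y" and w: "continuous_on {0..t} w"
    and eq: "\<And>s. 0 \<le> s \<Longrightarrow> s \<le> t \<Longrightarrow> y s = - \<kappa> * integral {0..s} y + w s"
  shows "y t = w t - \<kappa> * exp (- \<kappa> * t) * integral {0..t} (\<lambda>s. exp (\<kappa> * s) * w s)"
proof -
  let ?I = "\<lambda>s. exp (\<kappa> * s) * integral {0..s} y"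
  have "(?I has_vector_derivative exp (\<kappa> * s) * w s) (at s within {0..t})" if s: "s \<in> {0..t}" for s
  proof -
    have "((\<lambda>s. integral {0..s} y) has_real_derivative y s) (at s within {0..t})"
      using integral_has_vector_derivative[OF y s]
      by (simp add: has_real_derivative_iff_has_vector_derivative)
    then have "(?I has_real_derivative
        (\<kappa> * exp (\<kappa> * s) * integral {0..s} y + exp (\<kappa> * s) * y s)) (at s within {0..t})"
      by (auto intro!: derivative_eq_intros)
    moreover have "\<kappa> * exp (\<kappa> * s) * integral {0..s} y + exp (\<kappa> * s) * y s = exp (\<kappa> * s) * w s"
    proof -
      have "w s = y s + \<kappa> * integral {0..s} y" using eq[of s] s by simp
      then show ?thesis by (simp add: algebra_simps)
    qed
    ultimately show ?thesis
      by (simp add: has_real_derivative_iff_has_vector_derivative)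
  qed
  then have "((\<lambda>s. exp (\<kappa> * s) * w s) has_integral (?I t - ?I 0)) {0..t}"
    by (intro fundamental_theorem_of_calculus \<open>t \<ge> 0\<close>) auto
  then have "integral {0..t} (\<lambda>s. exp (\<kappa> * s) * w s) = ?I t"
    by (simp add: integral_unique)
  then show ?thesis
    using eq[of t] \<open>t \<ge> 0\<close> by (simp add: exp_minus)
qed

text \<open>The explicit solution is linear in the path of \<open>W\<close>, and linear functionals
  are odd. Its time integral is reached through Riemann sums, on the almost sure event where the
  path is continuous.\<close>

lemma common_functional_ou_process:
  assumes W: "standard_brownian_motion M W" and Y: "ou_process M \<kappa> W Y" and "t \<ge> 0"
  shows "common_functional M path_space (\<lambda>\<omega>. \<lambda>t\<in>{0..}. W t \<omega>) (\<lambda>\<omega>. \<lambda>t\<in>{0..}. - W t \<omega>)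
    (Y t) (\<lambda>\<omega>. - Y t \<omega>)"
proof -
  let ?CF = "common_functional M path_space (\<lambda>\<omega>. \<lambda>t\<in>{0..}. W t \<omega>) (\<lambda>\<omega>. \<lambda>t\<in>{0..}. - W t \<omega>)"
  have CF_W: "?CF (W s) (\<lambda>\<omega>. - W s \<omega>)" if "s \<ge> 0" for s
    by (rule common_functionalI[where F = "\<lambda>x. x s"])
      (use that in \<open>auto intro!: measurable_component_singleton\<close>)
  let ?f = "\<lambda>\<omega> s. exp (\<kappa> * s) * W s \<omega>"
  have contW: "AE \<omega> in M. continuous_on {0..t} (\<lambda>s. W s \<omega>)"
  proof -
    have "AE \<omega> in M. continuous_on {0..} (\<lambda>s. W s \<omega>)"
      using W by (simp add: standard_brownian_motion_def)
    then show ?thesis by eventually_elim (auto intro: continuous_on_subset)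
  qed
  have lim: "AE \<omega> in M. (\<lambda>n. \<Sum>k<Suc n. t / real (Suc n) * ?f \<omega> (t * real k / real (Suc n)))
      \<longlonglongrightarrow> integral {0..t} (?f \<omega>)"
    using contW
  proof eventually_elim
    case (elim \<omega>)
    then show ?case
      by (intro riemann_sums_tendsto_integral \<open>t \<ge> 0\<close> continuous_intros)
  qed
  have CF_I: "?CF (\<lambda>\<omega>. integral {0..t} (?f \<omega>)) (\<lambda>\<omega>. - integral {0..t} (?f \<omega>))"
  proof (rule common_functional_lim[OF _ lim])
    show "?CF (\<lambda>\<omega>. \<Sum>k<Suc n. t / real (Suc n) * ?f \<omega> (t * real k / real (Suc n)))
        (\<lambda>\<omega>. \<Sum>k<Suc n. t / real (Suc n) *
          (exp (\<kappa> * (t * real k / real (Suc n))) * - W (t * real k / real (Suc n)) \<omega>))" for n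
      by (intro common_functional_sum common_functional_cmult CF_W) (use \<open>t \<ge> 0\<close> in auto)
    show "AE \<omega> in M. (\<lambda>n. \<Sum>k<Suc n. t / real (Suc n) *
          (exp (\<kappa> * (t * real k / real (Suc n))) * - W (t * real k / real (Suc n)) \<omega>))
        \<longlonglongrightarrow> - integral {0..t} (?f \<omega>)"
      using lim
    proof eventually_elim
      case (elim \<omega>)
      then show ?case using tendsto_minus[OF elim] by (simp add: sum_negf)
    qed
  qed
  have "AE \<omega> in M. Y t \<omega> = W t \<omega> - \<kappa> * exp (- \<kappa> * t) * integral {0..t} (?f \<omega>)"
  proof -
    have "AE \<omega> in M. continuous_on {0..} (\<lambda>t. Y t \<omega>) \<and>
        (\<forall>t\<ge>0. Y t \<omega> = - \<kappa> * integral {0..t} (\<lambda>s. Y s \<omega>) + W t \<omega>)"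
      using Y by (auto simp: ou_process_def elim!: eventually_mono)
    with contW show ?thesis
    proof eventually_elim
      case (elim \<omega>)
      then show ?case
        by (intro linear_integral_equation_solution \<open>t \<ge> 0\<close>) (auto intro: continuous_on_subset)
    qed
  qed
  then show ?thesis
    by (intro common_functional_cong_AE[OF common_functional_diff[OF CF_W[OF \<open>t \<ge> 0\<close>]
            common_functional_cmult[OF CF_I, of "\<kappa> * exp (- \<kappa> * t)"]]]) auto
qed

lemma symmetric_process_ou_process:
  assumes "prob_space M" "standard_brownian_motion M W" "ou_process M \<kappa> W Y"
  shows "symmetric_process M Y"
proof (rule symmetric_process_common_functional)
  show "symmetric_process M W"
    using assms(1,2) by (rule symmetric_process_brownian_motion)
qed (use assms in \<open>auto simp: standard_brownian_motion_def ou_process_def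
    intro: common_functional_ou_process\<close>)

section \<open>Joint symmetry of the coordinates and vanishing mixed moments\<close>

text \<open>Symmetry of each coordinate alone would not give joint symmetry. Independence makes the
  joint law a product, in which every factor may be reflected separately.\<close>

lemma distr_independent_processes_uminus:
  fixes Y :: "'d::finite \<Rightarrow> real \<Rightarrow> 'a \<Rightarrow> real"
  assumes "prob_space M" "independent_processes M Y"
    and meas: "\<And>j t. t \<ge> 0 \<Longrightarrow> Y j t \<in> borel_measurable M"
    and sym: "\<And>j. symmetric_process M (Y j)"
  shows "distr M (Pi\<^sub>M UNIV (\<lambda>_. path_space)) (\<lambda>\<omega> j. \<lambda>t\<in>{0..}. Y j t \<omega>)
       = distr M (Pi\<^sub>M UNIV (\<lambda>_. path_space)) (\<lambda>\<omega> j. \<lambda>t\<in>{0..}. - Y j t \<omega>)"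
proof -
  interpret prob_space M by fact
  have indep: "indep_vars (\<lambda>_. path_space) (\<lambda>j \<omega>. \<lambda>t\<in>{0..}. Y j t \<omega>) UNIV"
    using assms(2) by (simp add: independent_processes_def)
  have "indep_vars (\<lambda>_. path_space) (\<lambda>j \<omega>. \<lambda>t\<in>{0..}. - (\<lambda>t\<in>{0..}. Y j t \<omega>) t) UNIV"
    by (rule indep_vars_compose2[OF indep, of "\<lambda>_ x. \<lambda>t\<in>{0..}. - x t"])
      (auto intro!: measurable_restrict measurable_component_singleton borel_measurable_uminus)
  then have indep': "indep_vars (\<lambda>_. path_space) (\<lambda>j \<omega>. \<lambda>t\<in>{0..}. - Y j t \<omega>) UNIV"
    by (simp cong: restrict_cong)
  note mY = path_measurable[of "Y j" for j, OF meas]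
  have "distr M (Pi\<^sub>M UNIV (\<lambda>_. path_space)) (\<lambda>\<omega> j. \<lambda>t\<in>{0..}. Y j t \<omega>)
      = Pi\<^sub>M UNIV (\<lambda>j. distr M path_space (\<lambda>\<omega>. \<lambda>t\<in>{0..}. Y j t \<omega>))"
    using indep mY(1) by (subst (asm) indep_vars_iff_distr_eq_PiM') (auto simp: restrict_UNIV)
  also have "\<dots> = Pi\<^sub>M UNIV (\<lambda>j. distr M path_space (\<lambda>\<omega>. \<lambda>t\<in>{0..}. - Y j t \<omega>))"
    using sym by (simp add: symmetric_process_def)
  also have "\<dots> = distr M (Pi\<^sub>M UNIV (\<lambda>_. path_space)) (\<lambda>\<omega> j. \<lambda>t\<in>{0..}. - Y j t \<omega>)"
    using indep' mY(2) by (subst (asm) indep_vars_iff_distr_eq_PiM') (auto simp: restrict_UNIV)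
  finally show ?thesis .
qed

text \<open>\<open>Y\<close> stands for the Brownian or the OU coordinates. Since \<Gamma> is
  linear, reflecting \<open>Y\<close> reflects \<open>X\<close>; the product of the two components
  then acquires the sign (-1)^(|v| + |w|) = -1, so it is an odd functional of a symmetric random
  element.\<close>

lemma integral_signature_odd_eq_0:
  fixes X :: "real \<Rightarrow> 'a \<Rightarrow> real^'d" and \<Gamma> :: "real^'d^'d"
  assumes M: "prob_space M" and S: "is_signature M c X S"
    and indep: "independent_processes M Y"
    and meas: "\<And>j t. t \<ge> 0 \<Longrightarrow> Y j t \<in> borel_measurable M"
    and sym: "\<And>j. symmetric_process M (Y j)"
    and X: "\<And>t \<omega>. t \<ge> 0 \<Longrightarrow> \<omega> \<in> space M \<Longrightarrow> X t \<omega> = \<Gamma> *v (\<chi> j. Y j t \<omega>)"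
    and "t \<ge> 0" "odd (length v + length w)"
  shows "(\<integral>\<omega>. S v t \<omega> * S w t \<omega> \<partial>M) = 0"
proof -
  let ?N = "Pi\<^sub>M UNIV (\<lambda>_::'d. path_space)"
  let ?\<Phi> = "\<lambda>\<omega> j. \<lambda>t\<in>{0..}. Y j t \<omega>" and ?\<Psi> = "\<lambda>\<omega> j. \<lambda>t\<in>{0..}. - Y j t \<omega>"
  let ?CF = "common_functional M ?N ?\<Phi> ?\<Psi>"
  have X': "vec_nth (X s \<omega>) i = (\<Sum>j\<in>UNIV. vec_nth (vec_nth \<Gamma> i) j * Y j s \<omega>)"
    if "s \<ge> 0" "\<omega> \<in> space M" for s \<omega> i
    using X[OF that] by (simp add: matrix_vector_mult_def)
  have X_meas: "(\<lambda>\<omega>. vec_nth (X s \<omega>) i) \<in> borel_measurable M" if "s \<ge> 0" for s i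
    using that by (subst measurable_cong[OF X'])
      (auto intro!: borel_measurable_sum borel_measurable_times meas)
  have CF_Y: "?CF (Y j s) (\<lambda>\<omega>. - Y j s \<omega>)" if "s \<ge> 0" for j s
  proof (rule common_functionalI[where F = "\<lambda>x. x j s"])
    show "(\<lambda>x. x j s) \<in> borel_measurable ?N"
      using that by (intro measurable_compose[where f = "\<lambda>x. x j" and g = "\<lambda>x. x s" and N = path_space]
          measurable_component_singleton) auto
  qed (use that in auto)
  have CF_X: "?CF (\<lambda>\<omega>. vec_nth (X s \<omega>) i) (\<lambda>\<omega>. - vec_nth (X s \<omega>) i)" if "s \<ge> 0" for s i
  proof -
    have "?CF (\<lambda>\<omega>. \<Sum>j\<in>UNIV. vec_nth (vec_nth \<Gamma> i) j * Y j s \<omega>)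
        (\<lambda>\<omega>. \<Sum>j\<in>UNIV. vec_nth (vec_nth \<Gamma> i) j * - Y j s \<omega>)"
      by (intro common_functional_sum common_functional_cmult CF_Y that)
    then show ?thesis
      by (rule common_functional_cong_AE) (use X'[OF that] in \<open>auto simp: sum_negf\<close>)
  qed
  have CF_S: "?CF (S u t) (\<lambda>\<omega>. (- 1) ^ length u * S u t \<omega>)" for u
    by (rule common_functional_signature[OF M S X_meas CF_X \<open>t \<ge> 0\<close>])
  have sign: "(- 1 :: real) ^ length v * (- 1) ^ length w = - 1"
    using \<open>odd (length v + length w)\<close> by (simp flip: power_add)
  have "?CF (\<lambda>\<omega>. S v t \<omega> * S w t \<omega>)
      (\<lambda>\<omega>. ((- 1) ^ length v * S v t \<omega>) * ((- 1) ^ length w * S w t \<omega>))"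
    by (intro common_functional_mult CF_S)
  moreover have "((- 1) ^ length v * a) * ((- 1) ^ length w * b) = - (a * b)" for a b :: real
  proof -
    have "((- 1) ^ length v * a) * ((- 1) ^ length w * b)
        = ((- 1) ^ length v * (- 1) ^ length w) * (a * b)" by (simp only: ac_simps)
    then show ?thesis by (simp add: sign)
  qed
  ultimately have "?CF (\<lambda>\<omega>. S v t \<omega> * S w t \<omega>) (\<lambda>\<omega>. - (S v t \<omega> * S w t \<omega>))"
    by (simp only:)
  moreover have "(\<lambda>\<omega>. \<lambda>j\<in>UNIV. ?\<Phi> \<omega> j) \<in> measurable M ?N" "(\<lambda>\<omega>. \<lambda>j\<in>UNIV. ?\<Psi> \<omega> j) \<in> measurable M ?N"
    by (rule measurable_restrict, rule path_measurable, rule meas, assumption)+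
  then have "?\<Phi> \<in> measurable M ?N" "?\<Psi> \<in> measurable M ?N"
    by (simp_all only: restrict_UNIV)
  ultimately show ?thesis
    using signature_measurable[OF S \<open>t \<ge> 0\<close>] distr_independent_processes_uminus[OF M indep meas sym]
    by (intro integral_eq_0_if_common_functional_uminus) auto
qed

section \<open>Block structure of correlation matrices\<close>

text \<open>With lower blocks of zero rows, \<open>four_block_mat\<close> is horizontal
  juxtaposition, the form used by \<open>append_cols_list\<close>.\<close>

lemma correlation_matrix_append_cols:
  "correlation_matrix M U us (vs @ vs') =
     four_block_mat (correlation_matrix M U us vs) (correlation_matrix M U us vs')
       (0\<^sub>m 0 (length vs)) (0\<^sub>m 0 (length vs'))"
  by (rule eq_matI) (auto simp: correlation_matrix_def nth_append)

lemma correlation_matrix_append_rows: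
  "correlation_matrix M U (us @ us') vs =
     correlation_matrix M U us vs @\<^sub>r correlation_matrix M U us' vs"
  by (rule eq_matI) (auto simp: correlation_matrix_def nth_append append_rows_def)

text \<open>The empty case is excluded because \<open>append_cols_list\<close> forgets the number of rows there.\<close>

lemma append_cols_list_correlation_matrix:
  assumes "ns \<noteq> []"
  shows "append_cols_list (map (\<lambda>n. correlation_matrix M U us (ws n)) ns) =
    correlation_matrix M U us (concat (map ws ns))"
  using assms
proof (induction ns rule: list_nonempty_induct)
  case (single n)
  show ?case
    by (rule eq_matI) (auto simp: correlation_matrix_def Let_def)
next
  case (cons n ns)
  then show ?case
    by (simp add: Let_def correlation_matrix_append_cols) (simp add: correlation_matrix_def)
qed

text \<open>Appending rows takes the width from the upper matrix, so the final
  \<open>0\<^sub>m 0 0\<close> does no harm below a block; on its own it would have the wrong number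
  of columns.\<close>

lemma append_rows_list_correlation_matrix:
  assumes "ms \<noteq> []"
  shows "append_rows_list (map (\<lambda>m. correlation_matrix M U (ws m) vs) ms) =
    correlation_matrix M U (concat (map ws ms)) vs"
  using assms
proof (induction ms rule: list_nonempty_induct)
  case (single m)
  show ?case
    by (rule eq_matI) (auto simp: correlation_matrix_def append_rows_def)
qed (simp add: correlation_matrix_append_rows)

lemma block_matrix_correlation_matrix:
  "block_matrix ns ns (\<lambda>m n. correlation_matrix M U (ws m) (ws n)) =
     correlation_matrix M U (concat (map ws ns)) (concat (map ws ns))"
proof (cases "ns = []")
  \<comment> \<open>This case is met by the odd orders when \<open>K = 0\<close>; both sides are
    then 0 by 0 matrices.\<close>
  case True
  then show ?thesis by (auto simp: block_matrix_def correlation_matrix_def intro!: eq_matI)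
next
  case False
  then show ?thesis
    by (simp add: block_matrix_def append_cols_list_correlation_matrix append_rows_list_correlation_matrix)
qed

lemma block_matrix_cong:
  assumes "\<And>m n. m \<in> set ms \<Longrightarrow> n \<in> set ns \<Longrightarrow> B m n = B' m n"
  shows "block_matrix ms ns B = block_matrix ms ns B'"
  unfolding block_matrix_def using assms
  by (intro arg_cong[where f = append_rows_list] arg_cong[where f = append_cols_list] map_cong refl) auto

lemma correlation_matrix_eq_0:
  assumes "\<And>u v. u \<in> set us \<Longrightarrow> v \<in> set vs \<Longrightarrow> (\<integral>\<omega>. U u \<omega> * U v \<omega> \<partial>M) = 0"
  shows "correlation_matrix M U us vs = 0\<^sub>m (length us) (length vs)"
  by (rule eq_matI) (simp_all add: correlation_matrix_def uncentered_correlation_def assms)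

lemma correlation_matrix_append_diag:
  assumes "\<And>u v. u \<in> set us \<Longrightarrow> v \<in> set vs \<Longrightarrow> (\<integral>\<omega>. U u \<omega> * U v \<omega> \<partial>M) = 0"
  shows "correlation_matrix M U (us @ vs) (us @ vs) =
    diag_block_mat [correlation_matrix M U us us, correlation_matrix M U vs vs]"
proof -
  have "uncentered_correlation M (U u) (U v) = 0" "uncentered_correlation M (U v) (U u) = 0"
    if "u \<in> set us" "v \<in> set vs" for u v
    using assms[OF that] by (simp_all add: uncentered_correlation_def mult.commute)
  then show ?thesis
    by (intro eq_matI) (auto simp: correlation_matrix_def nth_append Let_def)
qed

theorem theorem4:
  fixes M :: "'a measure"
    and X :: "real \<Rightarrow> 'a \<Rightarrow> real^'d"
    and S :: "'d list \<Rightarrow> real \<Rightarrow> 'a \<Rightarrow> real"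
    and t :: real
    and K :: nat
    and words :: "nat \<Rightarrow> 'd list list"
  assumes "prob_space M"
    and "(multidim_brownian_motion M X \<and> is_signature M Stratonovich X S) \<or>
         (multidim_ou_process M X \<and> is_signature M Ito X S) \<or>
         (multidim_ou_process M X \<and> is_signature M Stratonovich X S)"
    and "t > 0"
    and "\<And>w. length w \<le> 2 * K \<Longrightarrow> (\<integral>\<omega>. (S w t \<omega>)\<^sup>2 \<partial>M) > 0"
    and "\<And>k. k \<le> 2 * K \<Longrightarrow> distinct (words k) \<and> set (words k) = {w. length w = k}"
  shows "let corr = correlation_matrix M (\<lambda>w. S w t);
             \<Psi> = (\<lambda>m n. corr (words m) (words n));
             orders = [0..<2 * K + 1];
             odds = map (\<lambda>k. 2 * k + 1) [0..<K];
             evens = map (\<lambda>k. 2 * k) [0..<K + 1];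
             comps = concat (map words orders);
             rearranged = concat (map words odds) @ concat (map words evens)
         in corr comps comps =
              block_matrix orders orders
                (\<lambda>m n. if even (m + n) then \<Psi> m n
                       else 0\<^sub>m (length (words m)) (length (words n))) \<and>
            corr rearranged rearranged =
              diag_block_mat [block_matrix odds odds \<Psi>, block_matrix evens evens \<Psi>]"
proof -
  \<comment> \<open>All three settings are reduced to one: a linear image of independent symmetric
    processes, with integrals in some fixed sense \<open>c\<close>.\<close>
  obtain c Y and \<Gamma> :: "real^'d^'d" where S: "is_signature M c X S" and Y: "independent_processes M Y"
    "\<And>j t. t \<ge> 0 \<Longrightarrow> Y j t \<in> borel_measurable M" "\<And>j. symmetric_process M (Y j)"
    and X: "\<And>t \<omega>. t \<ge> 0 \<Longrightarrow> \<omega> \<in> space M \<Longrightarrow> X t \<omega> = \<Gamma> *v (\<chi> j. Y j t \<omega>)"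
  proof -
    \<comment> \<open>The two OU settings are merged by leaving the sense of integration
      arbitrary.\<close>
    consider "multidim_brownian_motion M X" "is_signature M Stratonovich X S"
      | c where "multidim_ou_process M X" "is_signature M c X S"
      using assms(2) by blast
    then show ?thesis
    proof cases
      case 1
      from this(1) obtain \<Gamma> :: "real^'d^'d" and W where W: "\<forall>j. standard_brownian_motion M (W j)" "independent_processes M W"
        and X: "\<forall>t\<ge>0. \<forall>\<omega>\<in>space M. X t \<omega> = \<Gamma> *v (\<chi> j. W j t \<omega>)"
        unfolding multidim_brownian_motion_def by blast
      show ?thesis
      proof (rule that[OF 1(2) W(2)])
        show "W j s \<in> borel_measurable M" if "s \<ge> 0" for j s
          using W(1) that by (simp add: standard_brownian_motion_def)
        show "symmetric_process M (W j)" for j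
          using assms(1) W(1) by (simp add: symmetric_process_brownian_motion)
      qed (use X in simp)
    next
      case 2
      from this(1) obtain \<Gamma> :: "real^'d^'d" and \<kappa> W Y where "\<forall>j. \<kappa> j > 0" and W: "\<forall>j. standard_brownian_motion M (W j)"
        and Y: "\<forall>j. ou_process M (\<kappa> j) (W j) (Y j)" "independent_processes M Y"
        and X: "\<forall>t\<ge>0. \<forall>\<omega>\<in>space M. X t \<omega> = \<Gamma> *v (\<chi> j. Y j t \<omega>)"
        unfolding multidim_ou_process_def by blast
      show ?thesis
      proof (rule that[OF 2(2) Y(2)])
        show "Y j s \<in> borel_measurable M" if "s \<ge> 0" for j s
          using Y(1) that by (simp add: ou_process_def)
        show "symmetric_process M (Y j)" for j
          using assms(1) W Y(1) by (blast intro: symmetric_process_ou_process)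
      qed (use X in simp)
    qed
  qed
  have odd_eq_0: "(\<integral>\<omega>. S v t \<omega> * S w t \<omega> \<partial>M) = 0" if "odd (length v + length w)" for v w
    using \<open>t > 0\<close> that by (intro integral_signature_odd_eq_0[OF assms(1) S Y X]) auto
  have len: "length w = k" if "w \<in> set (words k)" "k \<le> 2 * K" for w k
    using assms(5)[OF that(2)] that(1) by simp
  define corr where "corr = correlation_matrix M (\<lambda>w. S w t)"
  define orders where "orders = [0..<2 * K + 1]"
  define odds where "odds = map (\<lambda>k. 2 * k + 1) [0..<K]"
  define evens where "evens = map (\<lambda>k. 2 * k) [0..<K + 1]"
  \<comment> \<open>Cutting the matrix into blocks is pure bookkeeping, valid for any enumeration of
    the words; the probabilistic result enters only when the blocks of odd total order are replaced
    by zero.\<close>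
  have "corr (concat (map words orders)) (concat (map words orders)) =
      block_matrix orders orders (\<lambda>m n. corr (words m) (words n))"
    unfolding corr_def by (rule block_matrix_correlation_matrix[symmetric])
  also have "\<dots> = block_matrix orders orders
      (\<lambda>m n. if even (m + n) then corr (words m) (words n) else 0\<^sub>m (length (words m)) (length (words n)))"
  proof (rule block_matrix_cong)
    fix m n assume mn: "m \<in> set orders" "n \<in> set orders"
    show "corr (words m) (words n) =
        (if even (m + n) then corr (words m) (words n) else 0\<^sub>m (length (words m)) (length (words n)))"
    proof (cases "even (m + n)")
      case False
      have "corr (words m) (words n) = 0\<^sub>m (length (words m)) (length (words n))"
        unfolding corr_def
        by (rule correlation_matrix_eq_0, rule odd_eq_0)
          (use mn False len in \<open>auto simp: orders_def\<close>)
      with False show ?thesis by simp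
    qed simp
  qed
  finally have 1: "corr (concat (map words orders)) (concat (map words orders)) = \<dots>" .
  have "corr (concat (map words odds) @ concat (map words evens))
        (concat (map words odds) @ concat (map words evens)) =
      diag_block_mat [corr (concat (map words odds)) (concat (map words odds)),
        corr (concat (map words evens)) (concat (map words evens))]"
    unfolding corr_def
  proof (rule correlation_matrix_append_diag, rule odd_eq_0)
    fix v w assume vw: "v \<in> set (concat (map words odds))" "w \<in> set (concat (map words evens))"
    obtain k where "k < K" "v \<in> set (words (2 * k + 1))"
      using vw(1) by (auto simp: odds_def)
    then have v: "odd (length v)" using len[of v "2 * k + 1"] by simp
    obtain l where "l < K + 1" "w \<in> set (words (2 * l))"
      using vw(2) unfolding evens_def set_concat set_map set_upt by auto
    then have "even (length w)" using len[of w "2 * l"] by simp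
    with v show "odd (length v + length w)" by simp
  qed
  then have 2: "corr (concat (map words odds) @ concat (map words evens))
        (concat (map words odds) @ concat (map words evens)) =
      diag_block_mat [block_matrix odds odds (\<lambda>m n. corr (words m) (words n)),
        block_matrix evens evens (\<lambda>m n. corr (words m) (words n))]"
    unfolding corr_def block_matrix_correlation_matrix .
  show ?thesis
    unfolding Let_def
    using 1 2 unfolding corr_def orders_def odds_def evens_def by (rule conjI)
qed

end
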